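(* Let $G$ be a finite group with the following property: for any two elements $x, y \in G$ whose orders $k$ and $m$, respectively, are co-prime, the product $xy$ has order $km$. Then $G$ is nilpotent. *)

theory Defs
  imports "HOL-Algebra.Algebra"
begin

(* Commutators are written as in derived_set, [g, h] = g h g^{-1} h^{-1}.
   The series is indexed from 0, so lower_central_series G n is the subgroup
   usually written gamma_{n+1}(G). *)
primrec lower_central_series :: "('a, 'b) monoid_scheme \<Rightarrow> nat \<Rightarrow> 'a set" where
  "lower_central_series G 0 = carrier G"
| "lower_central_series G (Suc n) =
     generate G (\<Union>g \<in> carrier G. \<Union>h \<in> lower_central_series G n.
       { g \<otimes>\<^bsub>G\<^esub> h \<otimes>\<^bsub>G\<^esub> (inv\<^bsub>G\<^esub> g) \<otimes>\<^bsub>G\<^esub> (inv\<^bsub>G\<^esub> h) })"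

definition nilpotent_group :: "('a, 'b) monoid_scheme \<Rightarrow> bool" where
  "nilpotent_group G \<longleftrightarrow> group G \<and> (\<exists>n. lower_central_series G n = { \<one>\<^bsub>G\<^esub> })"

end

theory Submission
  imports Defs
begin

text \<open>
  If \<open>H\<close> is a Sylow subgroup for \<open>p\<close> and \<open>T\<close> consists of elements of order prime to \<open>p\<close>, then
  \<open>x s = y t\<close> with \<open>x, y \<in> H\<close> and \<open>s, t \<in> T\<close> gives \<open>(y\<inverse> x) s = t\<close>; comparing orders, \<open>y\<inverse> x = 1\<close>.
  Hence the product map on one Sylow subgroup for each prime is injective, and by counting it is onto
  the group. The order of such a product is the product of the orders of its factors, so every
  element of \<open>p\<close>-power order lies in the chosen Sylow subgroup for \<open>p\<close>: this subgroup is normal, and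
  elements of prime power order for distinct primes commute.

  The last property passes to quotients, and it makes the center of a nontrivial finite group
  nontrivial, because a central element of a Sylow subgroup is centralized by all other Sylow
  subgroups. Hence the upper central series reaches the whole group.
\<close>

section \<open>Centralizers, orders of elements and Sylow subgroups\<close>

hide_const (open) Divisibility.prime

definition centralizer :: "('a, 'b) monoid_scheme \<Rightarrow> 'a set \<Rightarrow> 'a set" where
  "centralizer G A = {x \<in> carrier G. \<forall>a \<in> A. x \<otimes>\<^bsub>G\<^esub> a = a \<otimes>\<^bsub>G\<^esub> x}"

text \<open>The exponent \<open>k = 0\<close> is allowed, so the identity belongs to each of these
  sets; only then can they be subgroups.\<close>

definition primary_elements :: "('a, 'b) monoid_scheme \<Rightarrow> nat \<Rightarrow> 'a set" where
  "primary_elements G p = {x \<in> carrier G. \<exists>k. group.ord G x = p ^ k}"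

text \<open>The condition speaks of elements rather than of chosen Sylow subgroups, so it can be
  transferred to a quotient by lifting cosets to representatives.\<close>

definition primary_elements_commute :: "('a, 'b) monoid_scheme \<Rightarrow> bool" where
  "primary_elements_commute G \<longleftrightarrow>
     (\<forall>p q x y. prime p \<longrightarrow> prime q \<longrightarrow> p \<noteq> q \<longrightarrow>
        x \<in> primary_elements G p \<longrightarrow> y \<in> primary_elements G q \<longrightarrow>
        x \<otimes>\<^bsub>G\<^esub> y = y \<otimes>\<^bsub>G\<^esub> x)"

context group
begin

lemma centralizer_subgroup:
  assumes "A \<subseteq> carrier G"
  shows "subgroup (centralizer G A) G"
proof (rule subgroupI)
  show "centralizer G A \<noteq> {}"
    using assms by (force simp: centralizer_def)
next
  fix x assume x: "x \<in> centralizer G A"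
  show "inv x \<in> centralizer G A"
    unfolding centralizer_def
  proof safe
    fix a assume a: "a \<in> A"
    have xc: "x \<in> carrier G" "a \<in> carrier G" and "x \<otimes> a = a \<otimes> x"
      using x a assms by (auto simp: centralizer_def)
    then have "inv x \<otimes> (x \<otimes> a) \<otimes> inv x = inv x \<otimes> (a \<otimes> x) \<otimes> inv x"
      by simp
    then show "inv x \<otimes> a = a \<otimes> inv x"
      using xc by (metis inv_closed inv_solve_left inv_solve_right m_assoc m_closed)
  qed (use x in \<open>auto simp: centralizer_def\<close>)
next
  fix x y assume "x \<in> centralizer G A" "y \<in> centralizer G A"
  then show "x \<otimes> y \<in> centralizer G A"
    using assms unfolding centralizer_def
    by (smt (verit, best) m_assoc m_closed mem_Collect_eq subsetD)
qed (auto simp: centralizer_def)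

lemma ord_dvd_card_subgroup:
  assumes "subgroup H G" "x \<in> H"
  shows "ord x dvd card H"
proof -
  have "x [^]\<^bsub>G\<lparr>carrier := H\<rparr>\<^esub> card H = \<one>"
    using group.pow_order_eq_1[OF subgroup.subgroup_is_group[OF assms(1) is_group], of x] assms(2)
    by (simp add: order_def)
  then have "x [^] card H = \<one>"
    by (simp add: nat_pow_consistent[symmetric])
  then show ?thesis
    using assms subgroup.mem_carrier pow_eq_id by metis
qed

lemma card_subgroup_dvd_order:
  assumes "subgroup H G"
  shows "card H dvd order G"
  using lagrange[OF assms] by (metis dvd_triv_right)

text \<open>Conjugation commutes with taking powers, so the same exponents kill \<open>x\<close> and
  its conjugate. This makes the sets \<open>primary_elements G p\<close> closed under
  conjugation.\<close>

lemma ord_conjugate: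
  assumes "x \<in> carrier G" "g \<in> carrier G"
  shows "ord (g \<otimes> x \<otimes> inv g) = ord x"
proof -
  have pow: "(g \<otimes> x \<otimes> inv g) [^] n = g \<otimes> x [^] n \<otimes> inv g" for n :: nat
  proof (induction n)
    case (Suc n)
    have "g \<otimes> x [^] n \<otimes> inv g \<otimes> (g \<otimes> x \<otimes> inv g) = g \<otimes> (x [^] n \<otimes> ((inv g \<otimes> g) \<otimes> x)) \<otimes> inv g"
      using assms by (simp only: m_assoc m_closed inv_closed nat_pow_closed)
    then show ?case
      using Suc assms by simp
  qed (use assms in simp)
  have "(g \<otimes> x \<otimes> inv g) [^] n = \<one> \<longleftrightarrow> x [^] n = \<one>" for n :: nat
    unfolding pow using assms by (metis inv_closed inv_inv inv_solve_right' l_cancel_one' m_closed nat_pow_closed one_closed r_inv r_one l_one)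
  then show ?thesis
    using assms by (simp add: ord_unique pow_eq_id)
qed

lemma sylow_subgroup_exists:
  assumes "finite (carrier G)" "prime p"
  obtains H where "subgroup H G" "card H = p ^ multiplicity p (order G)"
proof -
  have "order G = p ^ multiplicity p (order G) * (order G div p ^ multiplicity p (order G))"
    by (simp add: multiplicity_dvd)
  from sylow_thm[OF assms(2) is_group this assms(1)] that show ?thesis by blast
qed

text \<open>Lagrange's theorem inside \<open>C\<close> makes every full prime power of
  \<open>order G\<close> divide \<open>card C\<close>, hence \<open>order G\<close> itself divides
  it. The lemma serves to show that the centralizer of an element is the whole group.\<close>

lemma subgroup_eq_carrier_if_sylow:
  assumes fin: "finite (carrier G)" and C: "subgroup C G"
    and sylow: "\<And>p. prime p \<Longrightarrow> \<exists>H. subgroup H G \<and> card H = p ^ multiplicity p (order G) \<and> H \<subseteq> C"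
  shows "C = carrier G"
proof -
  have ord0: "order G \<noteq> 0"
    using fin order_gt_0_iff_finite by simp
  have finC: "finite C"
    using C fin finite_subset subgroup.subset by blast
  have C0: "card C \<noteq> 0"
    using finC subgroup.one_closed[OF C] by auto
  have "order G dvd card C"
  proof (rule multiplicity_le_imp_dvd[OF ord0])
    fix p :: nat assume p: "prime p"
    obtain H where H: "subgroup H G" "card H = p ^ multiplicity p (order G)" "H \<subseteq> C"
      using sylow[OF p] by blast
    have "subgroup H (G\<lparr>carrier := C\<rparr>)"
      using H C subgroup_incl by blast
    then have "card H dvd card C"
      using group.card_subgroup_dvd_order[OF subgroup.subgroup_is_group[OF C is_group]]
      by (simp add: order_def)
    then show "multiplicity p (order G) \<le> multiplicity p (card C)"
      using H(2) C0 p by (intro multiplicity_geI) auto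
  qed
  then have "card (carrier G) \<le> card C"
    using C0 by (auto simp: order_def dest: dvd_imp_le)
  then show ?thesis
    using C fin by (metis card_seteq subgroup.subset)
qed

end

section \<open>Fixed points of p-groups and nontrivial centers\<close>

text \<open>Orbit sizes divide \<open>p ^ a\<close>, so an orbit that is not a single fixed point
  has size divisible by \<open>p\<close>.\<close>

lemma (in group_action) card_fixed_points_mod_prime:
  assumes "finite E" "prime p" "order G = p ^ a"
  shows "card {x \<in> E. \<forall>g \<in> carrier G. \<phi> g x = x} mod p = card E mod p"
proof -
  let ?F = "{x \<in> E. \<forall>g \<in> carrier G. \<phi> g x = x}"
  \<comment> \<open>Fixed points are counted by their indicator function. Its sum over an orbit
    agrees modulo \<open>p\<close> with the size of the orbit, and the orbits partition
    \<open>E\<close>.\<close>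
  have orbit_mod: "(\<Sum>x\<in>orb. if x \<in> ?F then 1 else 0) mod p = (\<Sum>x\<in>orb. 1) mod p"
    if orb: "orb \<in> orbits G E \<phi>" for orb
  proof -
    obtain x where x: "x \<in> E" "orb = orbit G \<phi> x"
      using orb by (auto simp: orbits_def)
    have orbE: "orb \<subseteq> E"
      using orbits_coverture orb by blast
    show ?thesis
    proof (cases "x \<in> ?F")
      case True
      then have "orb = {x}"
        using x orbit_refl[of x] by (auto simp: orbit_def)
      then show ?thesis using True by simp
    next
      case False
      have notF: "y \<notin> ?F" if "y \<in> orb" for y
      proof
        assume "y \<in> ?F"
        then have "orbit G \<phi> y = {y}"
          using orbit_refl[of y] by (auto simp: orbit_def)
        moreover have "x \<in> orbit G \<phi> y"
          using orbit_sym x that orbE by blast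
        ultimately show False using False \<open>y \<in> ?F\<close> by simp
      qed
      have "card orb dvd p ^ a"
        using orbit_stabilizer_theorem[OF x(1)] assms(3) x(2) by (metis dvd_triv_left)
      then obtain k where k: "card orb = p ^ k"
        using assms(2) divides_primepow_nat by blast
      have "card orb \<noteq> 1"
      proof
        assume "card orb = 1"
        then obtain y where y: "orb = {y}" by (auto simp: card_1_singleton_iff)
        then have "orb = {x}" using orbit_refl[OF x(1)] x by auto
        then show False using False x by (auto simp: orbit_def)
      qed
      then have "p dvd card orb" using k by (cases k) auto
      moreover have "(\<Sum>x\<in>orb. if x \<in> ?F then 1 else 0) = (0::nat)"
        using notF by (intro sum.neutral) auto
      ultimately show ?thesis by simp
    qed
  qed
  have "card ?F = (\<Sum>x\<in>E. if x \<in> ?F then 1 else 0)"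
    using assms(1) by (simp add: sum.If_cases Int_def)
  also have "\<dots> = (\<Sum>orb\<in>orbits G E \<phi>. \<Sum>x\<in>orb. if x \<in> ?F then 1 else 0)"
    by (rule disjoint_sum[OF assms(1), symmetric])
  also have "\<dots> mod p = (\<Sum>orb\<in>orbits G E \<phi>. (\<Sum>x\<in>orb. if x \<in> ?F then 1 else 0) mod p) mod p"
    by (simp only: mod_sum_eq)
  also have "\<dots> = (\<Sum>orb\<in>orbits G E \<phi>. (\<Sum>x\<in>orb. 1) mod p) mod p"
    by (simp only: orbit_mod cong: sum.cong)
  also have "\<dots> = (\<Sum>orb\<in>orbits G E \<phi>. \<Sum>x\<in>orb. 1) mod p"
    by (simp only: mod_sum_eq)
  also have "(\<Sum>orb\<in>orbits G E \<phi>. \<Sum>x\<in>orb. 1) = card E"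
    using disjoint_sum[OF assms(1), of "\<lambda>_. 1::nat"] by simp
  finally show ?thesis .
qed

context group
begin

text \<open>The center is the fixed-point set of the conjugation action, so its cardinality is
  divisible by \<open>p\<close> and cannot be 1.\<close>

lemma p_group_center_nontrivial:
  assumes "prime p" "order G = p ^ a" "0 < a"
  shows "centralizer G (carrier G) \<noteq> {\<one>}"
proof
  assume triv: "centralizer G (carrier G) = {\<one>}"
  let ?\<phi> = "\<lambda>g. \<lambda>h \<in> carrier G. g \<otimes> h \<otimes> inv g"
  have fin: "finite (carrier G)"
    using assms order_gt_0_iff_finite prime_gt_0_nat by simp
  have "{x \<in> carrier G. \<forall>g \<in> carrier G. ?\<phi> g x = x} = centralizer G (carrier G)"
    unfolding centralizer_def by (auto simp: inv_solve_right')
  then have "card (centralizer G (carrier G)) mod p = card (carrier G) mod p"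
    using group_action.card_fixed_points_mod_prime[OF action_by_conjugation fin assms(1,2)] by simp
  also have "\<dots> = 0"
    using assms by (simp add: order_def)
  finally show False
    using triv prime_gt_1_nat[OF assms(1)] by simp
qed

lemma center_nontrivial:
  assumes fin: "finite (carrier G)" and nontriv: "carrier G \<noteq> {\<one>}"
    and comm: "primary_elements_commute G"
  shows "centralizer G (carrier G) \<noteq> {\<one>}"
proof -
  have "order G \<noteq> 1" "order G \<noteq> 0"
    using nontriv fin order_one_triv_iff order_gt_0_iff_finite by auto
  then obtain p where p: "prime p" "p dvd order G"
    using prime_factor_nat by blast
  obtain P where P: "subgroup P G" "card P = p ^ multiplicity p (order G)"
    using sylow_subgroup_exists[OF fin p(1)] .
  have Pc: "P \<subseteq> carrier G" using P subgroup.subset by blast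
  have "0 < multiplicity p (order G)"
    using p \<open>order G \<noteq> 0\<close> by (simp add: prime_multiplicity_gt_zero_iff)
  then have "centralizer (G\<lparr>carrier := P\<rparr>) P \<noteq> {\<one>}"
    using group.p_group_center_nontrivial[OF subgroup.subgroup_is_group[OF P(1) is_group] p(1)] P(2)
    by (simp add: order_def)
  moreover have "\<one> \<in> centralizer (G\<lparr>carrier := P\<rparr>) P"
    using P(1) Pc by (auto simp: centralizer_def subgroup.one_closed)
  ultimately obtain z where z: "z \<in> P" "z \<noteq> \<one>" "\<And>x. x \<in> P \<Longrightarrow> z \<otimes> x = x \<otimes> z"
    by (auto simp: centralizer_def)
  have primary: "x \<in> primary_elements G q"
    if H: "subgroup H G" "card H = q ^ k" "prime q" "x \<in> H" for H q k x
    using ord_dvd_card_subgroup[OF H(1,4)] subgroup.mem_carrier[OF H(1,4)] H(2,3)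
    by (auto simp: primary_elements_def divides_primepow_nat)
  have zc: "z \<in> carrier G" using z Pc by blast
  \<comment> \<open>The centralizer of \<open>z\<close> contains a Sylow subgroup for every prime:
    \<open>P\<close> itself, because \<open>z\<close> is central in \<open>P\<close>, and any
    \<open>Q\<close> for \<open>q \<noteq> p\<close>, by the commuting hypothesis.\<close>
  have "centralizer G {z} = carrier G"
  proof (rule subgroup_eq_carrier_if_sylow[OF fin])
    show "subgroup (centralizer G {z}) G"
      using zc by (simp add: centralizer_subgroup)
    fix q :: nat assume q: "prime q"
    show "\<exists>H. subgroup H G \<and> card H = q ^ multiplicity q (order G) \<and> H \<subseteq> centralizer G {z}"
    proof (cases "q = p")
      case True
      then show ?thesis
        using P Pc z by (intro exI[of _ P]) (auto simp: centralizer_def)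
    next
      case False
      obtain Q where Q: "subgroup Q G" "card Q = q ^ multiplicity q (order G)"
        using sylow_subgroup_exists[OF fin q] .
      have "x \<otimes> z = z \<otimes> x" if "x \<in> Q" for x
        using comm primary[OF Q q that] primary[OF P p(1) z(1)] q p(1) False
        unfolding primary_elements_commute_def by blast
      then show ?thesis
        using Q subgroup.subset[OF Q(1)] by (intro exI[of _ Q]) (auto simp: centralizer_def)
    qed
  qed
  then have "z \<in> centralizer G (carrier G)"
    using zc unfolding centralizer_def by force
  then show ?thesis using z(2) by blast
qed

lemma lower_central_series_one_closed: "\<one> \<in> lower_central_series G n"
  by (cases n) (auto intro: generate.one)

end

section \<open>From centers of quotients to nilpotency\<close>

text \<open>The commutator equals \<open>(x \<otimes> z) \<otimes> inv (z \<otimes> x)\<close>,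
  which lies in \<open>H\<close> exactly when \<open>x \<otimes> z\<close> and
  \<open>z \<otimes> x\<close> have the same coset.\<close>

lemma (in normal) commutator_in_iff_coset_commute:
  assumes "x \<in> carrier G" "z \<in> carrier G"
  shows "x \<otimes> z \<otimes> inv x \<otimes> inv z \<in> H \<longleftrightarrow> (H #> x) <#> (H #> z) = (H #> z) <#> (H #> x)"
proof -
  have "x \<otimes> z \<otimes> inv x \<otimes> inv z = (x \<otimes> z) \<otimes> inv (z \<otimes> x)"
    using assms by (simp add: inv_mult_group m_assoc)
  moreover have "(x \<otimes> z) \<otimes> inv (z \<otimes> x) \<in> H \<longleftrightarrow> x \<otimes> z \<in> H #> (z \<otimes> x)"
    using assms rcos_module[OF is_group] by simp
  moreover have "x \<otimes> z \<in> H #> (z \<otimes> x) \<longleftrightarrow> H #> (x \<otimes> z) = H #> (z \<otimes> x)"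
    using assms subgroup_axioms by (metis m_closed repr_independence rcos_self)
  ultimately show ?thesis
    using assms by (simp add: rcos_sum)
qed

context group
begin

lemma nilpotent_if_quotients_have_center:
  assumes fin: "finite (carrier G)"
    and center: "\<And>N. N \<lhd> G \<Longrightarrow> N \<noteq> carrier G \<Longrightarrow>
       centralizer (G Mod N) (carrier (G Mod N)) \<noteq> {\<one>\<^bsub>G Mod N\<^esub>}"
  shows "nilpotent_group G"
proof -
  \<comment> \<open>If \<open>N\<close> is good and \<open>Z / N\<close> is the center of \<open>G / N\<close>, then \<open>[G, Z] \<subseteq> N\<close>, so \<open>Z\<close> is good too;
    a maximal good subgroup is therefore the whole group.\<close>
  define good where "good N \<longleftrightarrow> N \<lhd> G \<and>
    (\<forall>m. lower_central_series G m \<subseteq> N \<longrightarrow> (\<exists>n. lower_central_series G n = {\<one>}))" for N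
  have good_grows: "\<exists>Z. good Z \<and> N \<subset> Z" if good: "good N" and proper: "N \<noteq> carrier G" for N
  proof -
    have N: "N \<lhd> G" using good good_def by simp
    interpret N: normal N G by fact
    interpret Q: group "G Mod N" by (rule N.factorgroup_is_group)
    define Z where "Z = {z \<in> carrier G. N #> z \<in> centralizer (G Mod N) (carrier (G Mod N))}"
    have Zsub: "Z \<subseteq> carrier G" by (auto simp: Z_def)
    \<comment> \<open>\<open>Z\<close> is the preimage of the center of the quotient. Describing it
      by commutators links it to the lower central series.\<close>
    have Z_iff: "z \<in> Z \<longleftrightarrow> (\<forall>x \<in> carrier G. x \<otimes> z \<otimes> inv x \<otimes> inv z \<in> N)"
      if "z \<in> carrier G" for z
    proof -
      have "N #> z \<in> centralizer (G Mod N) (carrier (G Mod N)) \<longleftrightarrow>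
        (\<forall>x \<in> carrier G. (N #> x) <#> (N #> z) = (N #> z) <#> (N #> x))"
        using that unfolding centralizer_def carrier_FactGroup mult_FactGroup by auto
      then show ?thesis
        using that N.commutator_in_iff_coset_commute by (simp add: Z_def)
    qed
    have hom: "(\<lambda>x. N #> x) \<in> hom G (G Mod N)"
      by (rule N.r_coset_hom_Mod)
    interpret h: group_hom G "G Mod N" "\<lambda>x. N #> x"
      by (simp add: group_hom_def group_hom_axioms_def hom N.factorgroup_is_group)
    have sub: "subgroup Z G"
    proof (rule subgroupI)
      have C: "subgroup (centralizer (G Mod N) (carrier (G Mod N))) (G Mod N)"
        by (rule Q.centralizer_subgroup) simp
      show "inv x \<in> Z" if "x \<in> Z" for x
        using that subgroup.m_inv_closed[OF C, of "N #> x"] h.hom_inv[of x] by (auto simp: Z_def)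
      show "x \<otimes> y \<in> Z" if "x \<in> Z" "y \<in> Z" for x y
        using that subgroup.m_closed[OF C, of "N #> x" "N #> y"] by (auto simp: Z_def)
      show "Z \<noteq> {}"
        using subgroup.one_closed[OF C] h.hom_one by (auto simp: Z_def intro!: exI[of _ \<one>])
    qed (rule Zsub)
    have NZ: "N \<subseteq> Z"
    proof
      fix z assume z: "z \<in> N"
      have "x \<otimes> z \<otimes> inv x \<otimes> inv z \<in> N" if "x \<in> carrier G" for x
        using z that by (simp add: N.inv_op_closed2)
      then show "z \<in> Z" using Z_iff[OF N.mem_carrier[OF z]] by blast
    qed
    have normal: "Z \<lhd> G"
      unfolding normal_inv_iff
    proof (intro conjI ballI sub)
      fix x z assume x: "x \<in> carrier G" and z: "z \<in> Z"
      \<comment> \<open>The conjugate of \<open>z\<close> by \<open>x\<close> is this commutator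
        times \<open>z\<close>, and the commutator lies in \<open>N\<close>, hence in
        \<open>Z\<close>.\<close>
      have "x \<otimes> z \<otimes> inv x \<otimes> inv z \<in> Z"
        using NZ Z_iff[of z] x z Zsub by blast
      then have "x \<otimes> z \<otimes> inv x \<otimes> inv z \<otimes> z \<in> Z"
        using z sub subgroup.m_closed by metis
      then show "x \<otimes> z \<otimes> inv x \<in> Z"
        using x z Zsub by (simp add: subset_iff m_assoc)
    qed
    have "\<one>\<^bsub>G Mod N\<^esub> \<in> centralizer (G Mod N) (carrier (G Mod N))"
      by (rule subgroup.one_closed[OF Q.centralizer_subgroup]) simp
    then obtain C where C: "C \<in> centralizer (G Mod N) (carrier (G Mod N))" "C \<noteq> N"
      using center[OF N proper] by auto
    then obtain z where z: "z \<in> carrier G" "C = N #> z"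
      unfolding centralizer_def carrier_FactGroup by auto
    have "z \<in> Z"
      using z C(1) by (simp add: Z_def)
    moreover have "z \<notin> N"
      using z C(2) N.rcos_const[OF is_group] by blast
    ultimately have "N \<subset> Z" using NZ by blast
    moreover have "good Z"
      unfolding good_def
    proof (intro conjI normal allI impI)
      fix m assume sub_Z: "lower_central_series G m \<subseteq> Z"
      \<comment> \<open>The next term is generated by commutators of \<open>G\<close> with elements
        of \<open>Z\<close>, which lie in \<open>N\<close>; goodness of \<open>N\<close> then
        applies at index \<open>Suc m\<close>.\<close>
      have "lower_central_series G (Suc m) \<subseteq> N"
        unfolding lower_central_series.simps
      proof (intro generate_subgroup_incl[OF _ N.subgroup_axioms] UN_least)
        fix g h assume g: "g \<in> carrier G" and h: "h \<in> lower_central_series G m"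
        have "h \<in> Z" using sub_Z h by blast
        then show "{g \<otimes> h \<otimes> inv g \<otimes> inv h} \<subseteq> N"
          using Z_iff[of h] Zsub g by blast
      qed
      then show "\<exists>n. lower_central_series G n = {\<one>}"
        using good unfolding good_def by blast
    qed
    ultimately show ?thesis by blast
  qed
  \<comment> \<open>Every term of the series contains \<open>\<one>\<close>, so a term contained in
    \<open>{\<one>}\<close> equals it.\<close>
  have "good {\<one>}"
    unfolding good_def using one_is_normal lower_central_series_one_closed by blast
  moreover have "finite {N. good N}"
    by (rule finite_subset[of _ "Pow (carrier G)"])
      (use fin in \<open>auto simp: good_def dest: normal_imp_subgroup subgroup.subset\<close>)
  ultimately obtain M where M: "good M" "\<And>N. good N \<Longrightarrow> M \<subseteq> N \<Longrightarrow> N = M"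
    using finite_has_maximal[of "{N. good N}"] by auto
  then have "M = carrier G"
    using good_grows by blast
  \<comment> \<open>Goodness of the whole group is applied at index 0, where the series is
    \<open>carrier G\<close>.\<close>
  then show ?thesis
    using M(1) is_group unfolding good_def nilpotent_group_def
    by (metis lower_central_series.simps(1) order_refl)
qed

section \<open>Elements of prime power order in quotients\<close>

lemma primary_elements_lift_FactGroup:
  assumes fin: "finite (carrier G)" and N: "N \<lhd> G" and p: "prime p"
    and A: "A \<in> primary_elements (G Mod N) p"
  obtains x where "x \<in> primary_elements G p" "A = N #> x"
proof -
  interpret N: normal N G by fact
  interpret Q: group "G Mod N" by (rule N.factorgroup_is_group)
  interpret h: group_hom G "G Mod N" "\<lambda>x. N #> x"
    by (simp add: group_hom_def group_hom_axioms_def N.r_coset_hom_Mod N.factorgroup_is_group)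
  obtain k where k: "Q.ord A = p ^ k" and Ac: "A \<in> carrier (G Mod N)"
    using A by (auto simp: primary_elements_def)
  then obtain x where x: "x \<in> carrier G" "A = N #> x"
    by (auto simp: carrier_FactGroup)
  have "ord x \<noteq> 0"
    using ord_ge_1[OF fin x(1)] by simp
  then obtain m where m: "ord x = p ^ multiplicity p (ord x) * m" "\<not> p dvd m"
    using multiplicity_decompose'[of "ord x" p] p by (metis not_prime_unit)
  have "m \<noteq> 0" using m(2) by (cases m) auto
  \<comment> \<open>An exponent that is \<open>0\<close> modulo \<open>m\<close> and \<open>1\<close> modulo \<open>p ^ k\<close> kills the part of \<open>x\<close> of order
    prime to \<open>p\<close> without changing its coset.\<close>
  have "coprime m (p ^ k)"
    using prime_imp_coprime[OF p m(2)] by (simp add: coprime_commute)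
  \<comment> \<open>Bezout's identity in the natural numbers: since \<open>m \<noteq> 0\<close>, the
    coefficients can be chosen so that no subtraction occurs.\<close>
  then obtain u v where uv: "m * u = p ^ k * v + 1"
    using \<open>m \<noteq> 0\<close> bezout_nat[of m "p ^ k"] by auto
  have "ord (x [^] (m * u)) dvd p ^ multiplicity p (ord x)"
  proof -
    have "(x [^] (m * u)) [^] (p ^ multiplicity p (ord x)) = x [^] (ord x * u)"
      using x by (subst (2) m(1)) (simp add: nat_pow_pow mult_ac)
    also have "\<dots> = \<one>"
      using x pow_eq_id by simp
    finally show ?thesis using x pow_eq_id by simp
  qed
  then have "x [^] (m * u) \<in> primary_elements G p"
    using p x divides_primepow_nat by (auto simp: primary_elements_def)
  moreover have "N #> (x [^] (m * u)) = A"
  proof -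
    have hom: "N #> (x [^] (m * u)) = A [^]\<^bsub>G Mod N\<^esub> (p ^ k * v + 1)"
      by (simp only: uv h.hom_nat_pow[OF x(1)] x(2))
    have "A [^]\<^bsub>G Mod N\<^esub> (p ^ k * v) = \<one>\<^bsub>G Mod N\<^esub>"
      using k by (simp only: Q.pow_eq_id[OF Ac] dvd_triv_left)
    then have "A [^]\<^bsub>G Mod N\<^esub> (p ^ k * v + 1) = A"
      using Q.nat_pow_Suc[of A "p ^ k * v"] Q.l_one[OF Ac] by (simp only: Suc_eq_plus1)
    then show ?thesis using hom by simp
  qed
  ultimately show ?thesis using that by blast
qed

text \<open>Both cosets have representatives of prime power order for the same two primes; these
  commute in \<open>G\<close>, hence so do the cosets.\<close>

lemma primary_elements_commute_FactGroup:
  assumes "finite (carrier G)" "N \<lhd> G" "primary_elements_commute G"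
  shows "primary_elements_commute (G Mod N)"
  unfolding primary_elements_commute_def
proof (intro allI impI)
  fix p q :: nat and A B
  assume pq: "prime p" "prime q" "p \<noteq> q"
    and AB: "A \<in> primary_elements (G Mod N) p" "B \<in> primary_elements (G Mod N) q"
  obtain x where x: "x \<in> primary_elements G p" "A = N #> x"
    using primary_elements_lift_FactGroup[OF assms(1,2) pq(1) AB(1)] .
  obtain y where y: "y \<in> primary_elements G q" "B = N #> y"
    using primary_elements_lift_FactGroup[OF assms(1,2) pq(2) AB(2)] .
  have "x \<otimes> y = y \<otimes> x"
    using assms(3) pq x y unfolding primary_elements_commute_def by blast
  then show "A \<otimes>\<^bsub>G Mod N\<^esub> B = B \<otimes>\<^bsub>G Mod N\<^esub> A"
    using x y by (simp add: normal.rcos_sum[OF assms(2)] primary_elements_def)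
qed

lemma nilpotent_if_primary_elements_commute:
  assumes fin: "finite (carrier G)" and comm: "primary_elements_commute G"
  shows "nilpotent_group G"
proof (rule nilpotent_if_quotients_have_center[OF fin])
  fix N assume N: "N \<lhd> G" "N \<noteq> carrier G"
  interpret N: normal N G by fact
  interpret Q: group "G Mod N" by (rule N.factorgroup_is_group)
  have "carrier (G Mod N) \<noteq> {\<one>\<^bsub>G Mod N\<^esub>}"
  proof
    assume triv: "carrier (G Mod N) = {\<one>\<^bsub>G Mod N\<^esub>}"
    have "x \<in> N" if "x \<in> carrier G" for x
    proof -
      have "N #> x = N"
        using triv that by (auto simp: carrier_FactGroup)
      then show ?thesis using that rcos_self N.subgroup_axioms by blast
    qed
    then show False using N N.subset by blast
  qed
  then show "centralizer (G Mod N) (carrier (G Mod N)) \<noteq> {\<one>\<^bsub>G Mod N\<^esub>}"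
    using primary_elements_commute_FactGroup[OF fin N(1) comm] fin
    by (intro Q.center_nontrivial) (auto simp: carrier_FactGroup)
qed

end

section \<open>Consequences of the multiplicativity of coprime orders\<close>

locale coprime_ord_mult_group = group +
  assumes fin: "finite (carrier G)"
    and ord_mult: "\<lbrakk>x \<in> carrier G; y \<in> carrier G; coprime (ord x) (ord y)\<rbrakk>
      \<Longrightarrow> ord (x \<otimes> y) = ord x * ord y"
begin

lemma ord_pos: "x \<in> carrier G \<Longrightarrow> ord x \<noteq> 0"
  using ord_ge_1[OF fin] by fastforce

text \<open>\<open>T\<close> is only assumed to be a set, because it will be a product of several
  Sylow subgroups, which is not known to be a subgroup.\<close>

lemma mult_inj_if_coprime_ord:
  assumes H: "subgroup H G" and T: "T \<subseteq> carrier G"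
    and cop: "\<And>h t. h \<in> H \<Longrightarrow> t \<in> T \<Longrightarrow> coprime (ord h) (ord t)"
  shows "inj_on (\<lambda>(h, t). h \<otimes> t) (H \<times> T)"
proof (rule inj_onI; clarify)
  fix x s y t assume *: "x \<in> H" "s \<in> T" "y \<in> H" "t \<in> T" "x \<otimes> s = y \<otimes> t"
  have c: "x \<in> carrier G" "y \<in> carrier G" "s \<in> carrier G" "t \<in> carrier G"
    using *(1-4) T subgroup.mem_carrier[OF H] by blast+
  define w where "w = inv y \<otimes> x"
  have w: "w \<in> H"
    using * H by (simp add: w_def subgroup.m_closed subgroup.m_inv_closed)
  have wc: "w \<in> carrier G" by (rule subgroup.mem_carrier[OF H w])
  have ws: "w \<otimes> s = t"
    using * c by (simp add: w_def m_assoc inv_solve_left')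
  have "ord t = ord w * ord s"
    using ord_mult[OF wc c(3) cop[OF w *(2)]] ws by simp
  then have "ord w dvd ord t" by simp
  then have "ord w = 1"
    using cop[OF w *(4)] by (metis coprime_absorb_left nat_dvd_1_iff_1)
  then have "w = \<one>" using wc ord_eq_1 by blast
  then show "x = y \<and> s = t"
    using ws c unfolding w_def by (metis inv_closed inv_equality inv_inv l_one)
qed

text \<open>Induction on \<open>ps\<close>. The claim on prime factors is carried along because it
  makes the orders in the next subgroup coprime to those in the product so far; multiplication is
  then injective and the cardinalities multiply.\<close>

lemma prod_subgroups_card:
  assumes "distinct ps" "\<And>p. p \<in> set ps \<Longrightarrow> prime p \<and> subgroup (P p) G \<and> card (P p) = p ^ e p"
  shows "foldr (\<lambda>p T. P p <#> T) ps {\<one>} \<subseteq> carrier G \<and>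
    card (foldr (\<lambda>p T. P p <#> T) ps {\<one>}) = (\<Prod>p\<in>set ps. p ^ e p) \<and>
    (\<forall>s \<in> foldr (\<lambda>p T. P p <#> T) ps {\<one>}. prime_factors (ord s) \<subseteq> set ps)"
  using assms
proof (induction ps)
  case (Cons p ps)
  define T where "T = foldr (\<lambda>p T. P p <#> T) ps {\<one>}"
  have T: "T \<subseteq> carrier G" "card T = (\<Prod>p\<in>set ps. p ^ e p)"
    "\<And>s. s \<in> T \<Longrightarrow> prime_factors (ord s) \<subseteq> set ps"
    using Cons unfolding T_def by auto
  have p: "prime p" "subgroup (P p) G" "card (P p) = p ^ e p" "p \<notin> set ps"
    using Cons.prems by auto
  have Pc: "P p \<subseteq> carrier G" using p subgroup.subset by blast
  have ordP: "\<exists>k. ord h = p ^ k" if "h \<in> P p" for h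
    using ord_dvd_card_subgroup[OF p(2) that] p divides_primepow_nat by auto
  have cop: "coprime (ord h) (ord t)" if "h \<in> P p" "t \<in> T" for h t
  proof -
    have "t \<in> carrier G" using that T by blast
    have "\<not> p dvd ord t"
      using T(3)[OF that(2)] p ord_pos[OF \<open>t \<in> carrier G\<close>] by (auto simp: in_prime_factors_iff)
    then show ?thesis
      using ordP[OF that(1)] p(1) by (auto simp: prime_imp_coprime)
  qed
  have eq: "P p <#> T = (\<lambda>(h, t). h \<otimes> t) ` (P p \<times> T)"
    by (auto simp: set_mult_def)
  have "card (P p <#> T) = card (P p) * card T"
    unfolding eq using card_image[OF mult_inj_if_coprime_ord[OF p(2) T(1) cop]]
    by (simp add: card_cartesian_product)
  moreover have "prime_factors (ord s) \<subseteq> set (p # ps)" if s: "s \<in> P p <#> T" for s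
  proof -
    obtain h t where ht: "h \<in> P p" "t \<in> T" "s = h \<otimes> t"
      using s by (auto simp: set_mult_def)
    obtain k where k: "ord h = p ^ k" using ordP ht by blast
    have c: "h \<in> carrier G" "t \<in> carrier G" using ht T Pc by auto
    have "ord s = ord h * ord t"
      using ord_mult[OF c cop] ht by simp
    then have "prime_factors (ord s) = prime_factors (ord h) \<union> prime_factors (ord t)"
      using c ord_pos by (simp add: prime_factors_product)
    moreover have "prime_factors (ord h) \<subseteq> {p}"
      using k p(1) primes_dvd_imp_eq prime_dvd_power by (metis in_prime_factors_iff singleton_iff subsetI)
    ultimately show ?thesis using T(3)[OF ht(2)] by auto
  qed
  ultimately show ?case
    using T p Pc set_mult_closed[OF Pc T(1)] unfolding foldr.simps comp_def T_def[symmetric] by auto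
qed auto

text \<open>The set turns out to be the chosen Sylow subgroup \<open>P p\<close>. If
  \<open>g = h \<otimes> t\<close> has \<open>p\<close>-power order, with \<open>h\<close> in
  \<open>P p\<close> and \<open>ord t\<close> prime to \<open>p\<close>, then \<open>ord t\<close>
  divides \<open>ord g\<close>, so \<open>t\<close> is trivial.\<close>

lemma primary_elements_subgroup:
  assumes p: "prime p"
  shows "subgroup (primary_elements G p) G"
proof -
  define e where "e q = multiplicity q (order G)" for q
  define P where "P q = (SOME H. subgroup H G \<and> card H = q ^ e q)" for q
  have P: "subgroup (P q) G \<and> card (P q) = q ^ e q" if "prime q" for q
    unfolding P_def e_def
    by (rule someI_ex) (meson sylow_subgroup_exists[OF fin that])
  \<comment> \<open>The prime \<open>p\<close> is taken out and later put in front, so that the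
    whole product has the form \<open>P p <#> T\<close> with all orders in \<open>T\<close> prime to
    \<open>p\<close>.\<close>
  define ps where "ps = sorted_list_of_set (prime_factors (order G) - {p})"
  define T where "T = foldr (\<lambda>p T. P p <#> T) ps {\<one>}"
  have ps: "distinct (p # ps)" "set (p # ps) = insert p (prime_factors (order G))"
    "\<And>q. q \<in> set (p # ps) \<Longrightarrow> prime q"
    using p by (auto simp: ps_def in_prime_factors_iff)
  have T: "T \<subseteq> carrier G" "\<And>s. s \<in> T \<Longrightarrow> prime_factors (ord s) \<subseteq> set ps"
    using prod_subgroups_card[of ps P e] ps P unfolding T_def by auto
  have PT: "P p <#> T \<subseteq> carrier G" "card (P p <#> T) = (\<Prod>q\<in>set (p # ps). q ^ e q)"
    using prod_subgroups_card[OF ps(1), of P e] ps(3) P unfolding T_def by simp_all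
  have ord0: "order G \<noteq> 0"
    using fin order_gt_0_iff_finite by simp
  \<comment> \<open>If \<open>p\<close> does not divide \<open>order G\<close>, its factor is
    \<open>p ^ 0 = 1\<close>.\<close>
  have "(\<Prod>q\<in>set (p # ps). q ^ e q) = (\<Prod>q\<in>prime_factors (order G). q ^ e q)"
    unfolding ps(2)
    by (rule prod.mono_neutral_right)
      (use p ord0 in \<open>auto simp: e_def in_prime_factors_iff not_dvd_imp_multiplicity_0\<close>)
  also have "\<dots> = order G"
    unfolding e_def using prod_prime_factors[OF ord0] by simp
  finally have all: "P p <#> T = carrier G"
    using PT fin by (simp add: card_subset_eq order_def)
  have "primary_elements G p = P p"
  proof (intro equalityI subsetI)
    fix g assume "g \<in> primary_elements G p"
    then obtain k where g: "g \<in> carrier G" "ord g = p ^ k"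
      by (auto simp: primary_elements_def)
    then have "g \<in> P p <#> T" using all by simp
    then obtain h t where ht: "h \<in> P p" "t \<in> T" "g = h \<otimes> t"
      by (auto simp: set_mult_def)
    have c: "h \<in> carrier G" "t \<in> carrier G"
      using ht T(1) P[OF p] subgroup.mem_carrier by auto
    have "\<not> p dvd ord t"
      using T(2)[OF ht(2)] ps p ord_pos[OF c(2)] by (auto simp: in_prime_factors_iff)
    then have cop: "coprime (p ^ j) (ord t)" for j
      using p by (simp add: prime_imp_coprime)
    obtain j where j: "ord h = p ^ j"
      using ord_dvd_card_subgroup[OF _ ht(1)] P[OF p] p divides_primepow_nat by auto
    have "ord g = ord h * ord t"
      using ord_mult[OF c] cop j ht by simp
    then have "ord t dvd p ^ k" using g by simp
    then have "ord t = 1"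
      using cop[of k] by (metis coprime_absorb_right nat_dvd_1_iff_1)
    then show "g \<in> P p" using c ht ord_eq_1 by auto
  next
    fix g assume g: "g \<in> P p"
    then show "g \<in> primary_elements G p"
      using ord_dvd_card_subgroup[OF _ g] P[OF p] p subgroup.mem_carrier[OF _ g]
      by (auto simp: primary_elements_def divides_primepow_nat)
  qed
  then show ?thesis using P[OF p] by simp
qed

lemma primary_elements_commute: "primary_elements_commute G"
  unfolding primary_elements_commute_def
proof (intro allI impI)
  fix p q :: nat and x y
  assume pq: "prime p" "prime q" "p \<noteq> q"
    and x: "x \<in> primary_elements G p" and y: "y \<in> primary_elements G q"
  have c: "x \<in> carrier G" "y \<in> carrier G"
    using x y by (auto simp: primary_elements_def)
  \<comment> \<open>The commutator lies in both normal subgroups of primary elements.\<close>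
  define w where "w = x \<otimes> y \<otimes> inv x \<otimes> inv y"
  have wc: "w \<in> carrier G" using c by (simp add: w_def)
  \<comment> \<open>Conjugation preserves orders, which gives the normality of both
    subgroups.\<close>
  have conj: "g \<otimes> z \<otimes> inv g \<in> primary_elements G r"
    if "z \<in> primary_elements G r" "g \<in> carrier G" for g z r
    using that by (simp add: primary_elements_def ord_conjugate)
  note Sp = primary_elements_subgroup[OF pq(1)] and Sq = primary_elements_subgroup[OF pq(2)]
  have "w \<in> primary_elements G q"
    unfolding w_def using conj[OF y c(1)] subgroup.m_inv_closed[OF Sq y] by (rule subgroup.m_closed[OF Sq])
  then obtain j where j: "ord w = q ^ j" by (auto simp: primary_elements_def)
  \<comment> \<open>Here \<open>w\<close> is grouped as \<open>x\<close> times a conjugate of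
    \<open>inv x\<close>; for \<open>q\<close> it was a conjugate of \<open>y\<close> times
    \<open>inv y\<close>.\<close>
  have "x \<otimes> (y \<otimes> inv x \<otimes> inv y) \<in> primary_elements G p"
    using x conj[OF subgroup.m_inv_closed[OF Sp x] c(2)] by (rule subgroup.m_closed[OF Sp])
  then have "w \<in> primary_elements G p"
    using c by (simp add: w_def m_assoc)
  then obtain i where i: "ord w = p ^ i" by (auto simp: primary_elements_def)
  have "coprime (p ^ i) (q ^ j)"
    using pq by (simp add: primes_coprime)
  then have "ord w = 1"
    using i j by (metis coprime_self nat_dvd_1_iff_1)
  then have "w = \<one>" using wc ord_eq_1 by blast
  then have "(x \<otimes> y) \<otimes> inv (y \<otimes> x) = \<one>"
    using c by (simp add: w_def inv_mult_group m_assoc)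
  then show "x \<otimes> y = y \<otimes> x"
    using c by (metis inv_equality inv_inv inv_closed m_closed)
qed

end

theorem mainTheorem1:
  fixes G :: "('a, 'b) monoid_scheme" (structure)
  assumes "group G"
    and "finite (carrier G)"
    and "\<And>x y. \<lbrakk> x \<in> carrier G; y \<in> carrier G; coprime (group.ord G x) (group.ord G y) \<rbrakk>
           \<Longrightarrow> group.ord G (x \<otimes> y) = group.ord G x * group.ord G y"
  shows "nilpotent_group G"
proof -
  interpret coprime_ord_mult_group G
    using assms by (simp add: coprime_ord_mult_group_def coprime_ord_mult_group_axioms_def)
  show ?thesis
    by (rule nilpotent_if_primary_elements_commute[OF fin primary_elements_commute])
qed

end
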